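(* Let $G$ be an orientable ribbon graph and let $A\subseteq E(G)$. Then the partial dual $G^{A}$ is bipartite if and only if there is an all-crossing direction of the medial graph $G_m$ of $G$ such that $A$ is exactly the set of $c$-edges of $G$ arising from this all-crossing direction.
   Context: Graphs are finite, not necessarily connected, and may have loops and multiple edges. A graph is bipartite if it contains no cycle of odd length (in particular no loop). Ribbon graph. A ribbon graph $G=(V(G),E(G))$ is a (possibly non-orientable) surface with boundary represented as the union of two sets of topological discs, a set $V(G)$ of vertices and a set $E(G)$ of edges, such that: the vertices and edges intersect in disjoint line segments (common line segments); each such line segment lies on the boundary of precisely one vertex and precisely one edge; every edge contains exactly two such line segments. It is orientable if it is orientable as a surface. Removing the two common line segments from the boundary of an edge disc leaves its two edge line segments. Ribbon graphs are equivalent to graphs cellularly embedded in closed surfaces (gluing a disc to each boundary component gives the surface; the glued discs are the faces), and one moves freely between the two. Arrow presentation. An arrow presentation is a set of circles with labelled arrows on them, exactly two arrows for each label. It determines a ribbon graph: each circle is the boundary of a vertex disc; for each label $e$ take an edge disc, orient its boundary, place two disjoint arrows on its boundary pointing in the direction of the orientation, and identify these with the two $e$-labelled arrows. Partial dual. Let $A\subseteq E(G)$. Arbitrarily orient (the boundary of) and label each edge disc of $G$. The boundary components of the spanning ribbon subgraph $(V(G),A)$ meet the edges of $G$ in disjoint arcs (for $e\in A$ the two edge line segments of $e$; for $e\notin A$ the two common line segments of $e$). On each of these arcs place an arrow pointing in the direction of the orientation of the edge boundary, labelled by the edge it meets. The resulting arrow presentation determines the partial dual $G^A$. Medial graph.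 For $G$ cellularly embedded in $\Sigma$, the medial graph $G_m$ is the 4-regular graph embedded in $\Sigma$ obtained by placing a vertex $v(e)$ on each edge $e$ of $G$ and, for each face $f$ with boundary $v_1e_1v_2e_2\cdots v_{d}e_{d}$, drawing edges $(v(e_1),v(e_2)),(v(e_2),v(e_3)),\dots,(v(e_d),v(e_1))$ without intersections inside $f$ following its boundary (so edges of $G_m$ correspond to the corners of $G$). The canonical checkerboard colouring of $G_m$ colours black the faces of $G_m$ containing a vertex of $G$ and white the remaining faces; around each $v(e)$ the four corners are alternately black and white. All-crossing direction. An all-crossing direction of $G_m$ is an orientation of the edges of $G_m$ such that at each vertex $v(e)$ the four incident half-edges are, in cyclic order around $v(e)$, oriented "in, in, out, out". Then $v(e)$ is a $c$-vertex if the two incoming half-edges bound a black corner at $v(e)$ (equivalently, so do the two outgoing ones), and a $d$-vertex if the two incoming half-edges bound a white corner at $v(e)$. The edge $e$ of $G$ is a $c$-edge (resp. $d$-edge) if $v(e)$ is a $c$-vertex (resp. $d$-vertex). *)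

theory Defs
  imports Main
begin

section \<open>Graphs\<close>

text \<open>Multigraphs, with loops and parallel edges allowed.\<close>

record ('v, 'e) multigraph =
  verts :: "'v set"
  edgs :: "'e set"
  ends :: "'e \<Rightarrow> 'v set"

text \<open>The closed sequence \<open>v\<^sub>0 e\<^sub>0 v\<^sub>1 e\<^sub>1 \<dots> v\<^sub>k\<^sub>-\<^sub>1 e\<^sub>k\<^sub>-\<^sub>1 v\<^sub>0\<close>, of length \<open>k\<close>. A loop is a cycle of length 1,
  a pair of parallel edges is a cycle of length 2.\<close>

definition is_cycle :: "('v, 'e) multigraph \<Rightarrow> 'v list \<Rightarrow> 'e list \<Rightarrow> bool" where
  "is_cycle H vs es \<longleftrightarrow>
     es \<noteq> [] \<and> length vs = length es \<and> distinct vs \<and> distinct es \<and>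
     set vs \<subseteq> verts H \<and> set es \<subseteq> edgs H \<and>
     (\<forall>i < length es. ends H (es ! i) = {vs ! i, vs ! (Suc i mod length es)})"

definition bipartite :: "('v, 'e) multigraph \<Rightarrow> bool" where
  "bipartite H \<longleftrightarrow> \<not> (\<exists>vs es. is_cycle H vs es \<and> odd (length es))"


section \<open>Ribbon graphs\<close>

text \<open>A ribbon graph is determined by the way in which the boundaries of its discs are cut up by
  the end points of the common line segments. We call these end points flags; each edge disc has
  four of them. A flag \<open>p\<close> is joined

  \<^item> by a common line segment to \<open>comm G p\<close>,
  \<^item> by an edge line segment to \<open>side G p\<close>,
  \<^item> by an arc of the boundary of a vertex disc, running between two consecutive common line
    segments, to \<open>arc G p\<close>.

  So the boundary of an edge disc is a 4-cycle alternating between \<open>comm\<close> and \<open>side\<close>, the boundary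
  of a vertex disc is a cycle alternating between \<open>comm\<close> and \<open>arc\<close>, and a boundary component of the
  ribbon graph is a cycle alternating between \<open>arc\<close> and \<open>side\<close>. Vertex discs that meet no edge carry
  no flags, and are recorded in \<open>isolated G\<close>.\<close>

record ('f, 'v) ribbon =
  flags :: "'f set"
  comm :: "'f \<Rightarrow> 'f"
  side :: "'f \<Rightarrow> 'f"
  arc :: "'f \<Rightarrow> 'f"
  isolated :: "'v set"

definition matching_on :: "'f set \<Rightarrow> ('f \<Rightarrow> 'f) \<Rightarrow> bool" where
  "matching_on F t \<longleftrightarrow> (\<forall>p\<in>F. t p \<in> F \<and> t p \<noteq> p \<and> t (t p) = p)"

locale ribbon_graph =
  fixes G :: "('f, 'v) ribbon"
  assumes finite_flags: "finite (flags G)"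
    and finite_isolated: "finite (isolated G)"
    and comm: "matching_on (flags G) (comm G)"
    and side: "matching_on (flags G) (side G)"
    and arc: "matching_on (flags G) (arc G)"
    and comm_side: "p \<in> flags G \<Longrightarrow> comm G (side G p) = side G (comm G p)"
    and comm_neq_side: "p \<in> flags G \<Longrightarrow> comm G p \<noteq> side G p"

definition orbit :: "('f \<Rightarrow> 'f) \<Rightarrow> ('f \<Rightarrow> 'f) \<Rightarrow> 'f \<Rightarrow> 'f set" where
  "orbit s t p = {q. (\<lambda>x y. y = s x \<or> y = t x)\<^sup>*\<^sup>* p q}"

text \<open>Edge discs, vertex discs that meet an edge, and boundary components (faces) are identified with
  the sets of flags on their boundaries.\<close>

definition edge_at :: "('f, 'v) ribbon \<Rightarrow> 'f \<Rightarrow> 'f set" where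
  "edge_at G p = orbit (comm G) (side G) p"

definition vertex_at :: "('f, 'v) ribbon \<Rightarrow> 'f \<Rightarrow> 'f set" where
  "vertex_at G p = orbit (comm G) (arc G) p"

definition face_at :: "('f, 'v) ribbon \<Rightarrow> 'f \<Rightarrow> 'f set" where
  "face_at G p = orbit (arc G) (side G) p"

definition edges :: "('f, 'v) ribbon \<Rightarrow> 'f set set" where
  "edges G = edge_at G ` flags G"

definition vertices :: "('f, 'v) ribbon \<Rightarrow> 'f set set" where
  "vertices G = vertex_at G ` flags G"

definition faces :: "('f, 'v) ribbon \<Rightarrow> 'f set set" where
  "faces G = face_at G ` flags G"

definition underlying_graph :: "('f, 'v) ribbon \<Rightarrow> ('f set + 'v, 'f set) multigraph" where
  "underlying_graph G =
     \<lparr>verts = Inl ` vertices G \<union> Inr ` isolated G,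
      edgs = edges G,
      ends = (\<lambda>e. (\<lambda>p. Inl (vertex_at G p)) ` e)\<rparr>"

text \<open>An orientation of the boundaries of all edge discs is given by the set \<open>T\<close> of those flags which
  the oriented boundary leaves along a common line segment; it leaves the other flags along an edge
  line segment. Likewise, an orientation of the boundaries of all vertex discs is given by the
  set of those flags which the oriented boundary leaves along a common line segment.\<close>

definition edge_orientation :: "('f, 'v) ribbon \<Rightarrow> 'f set \<Rightarrow> bool" where
  "edge_orientation G T \<longleftrightarrow>
     (\<forall>p\<in>flags G. (p \<in> T \<longleftrightarrow> comm G p \<notin> T) \<and> (p \<in> T \<longleftrightarrow> side G p \<notin> T))"

definition vertex_orientation :: "('f, 'v) ribbon \<Rightarrow> 'f set \<Rightarrow> bool" where
  "vertex_orientation G S \<longleftrightarrow>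
     (\<forall>p\<in>flags G. (p \<in> S \<longleftrightarrow> comm G p \<notin> S) \<and> (p \<in> S \<longleftrightarrow> arc G p \<notin> S))"

text \<open>The surface is orientable iff its discs can be oriented coherently, that is, such that the two
  discs meeting in a common line segment induce opposite directions on it.\<close>

definition orientable :: "('f, 'v) ribbon \<Rightarrow> bool" where
  "orientable G \<longleftrightarrow>
     (\<exists>S T. vertex_orientation G S \<and> edge_orientation G T \<and> (\<forall>p\<in>flags G. p \<in> S \<longleftrightarrow> p \<notin> T))"


section \<open>Arrow presentations and partial duals\<close>

text \<open>An arrow is a triple of tail, head and label. The circles are cut up by the
  end points of the arrows; \<open>gap\<close> matches the two end points of each arc between consecutive arrows.
  Circles without arrows are recorded in \<open>bare\<close>.\<close>

record ('f, 'l, 'v) arrow_presentation =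
  points :: "'f set"
  arrows :: "('f \<times> 'f \<times> 'l) set"
  gap :: "'f \<Rightarrow> 'f"
  bare :: "'v set"

text \<open>Both arrows labelled \<open>l\<close> point in the direction of the oriented boundary of the edge disc \<open>l\<close>,
  so the edge line segments of this disc run from the head of each arrow to the tail of
  the other one.\<close>

definition ribbon_of_arrows :: "('f, 'l, 'v) arrow_presentation \<Rightarrow> ('f, 'v) ribbon" where
  "ribbon_of_arrows P =
     \<lparr>flags = points P,
      comm = (\<lambda>p. THE q. \<exists>l. (p, q, l) \<in> arrows P \<or> (q, p, l) \<in> arrows P),
      side = (\<lambda>p. THE q. \<exists>t h l.
         (t, p, l) \<in> arrows P \<and> (q, h, l) \<in> arrows P \<and> (t, p) \<noteq> (q, h) \<or>
         (p, h, l) \<in> arrows P \<and> (t, q, l) \<in> arrows P \<and> (p, h) \<noteq> (t, q)),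
      arc = gap P,
      isolated = bare P\<rparr>"

text \<open>The boundary components of the spanning ribbon subgraph with edge set \<open>A\<close> run along the edge
  line segments of the edges in \<open>A\<close>, along the common line segments of the edges not in \<open>A\<close>, and
  along all the arcs of the vertex boundaries between common line segments.\<close>

definition partial_dual_arrows ::
    "('f, 'v) ribbon \<Rightarrow> 'f set set \<Rightarrow> 'f set \<Rightarrow> ('f, 'f set, 'v) arrow_presentation" where
  "partial_dual_arrows G A T =
     \<lparr>points = flags G,
      arrows = {(p, side G p, edge_at G p) | p. p \<in> flags G \<and> edge_at G p \<in> A \<and> p \<notin> T} \<union>
               {(p, comm G p, edge_at G p) | p. p \<in> flags G \<and> edge_at G p \<notin> A \<and> p \<in> T},
      gap = arc G,
      bare = isolated G\<rparr>"

definition partial_dual :: "('f, 'v) ribbon \<Rightarrow> 'f set set \<Rightarrow> ('f, 'v) ribbon" where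
  "partial_dual G A =
     ribbon_of_arrows (partial_dual_arrows G A (SOME T. edge_orientation G T))"


section \<open>Medial graphs and all-crossing directions\<close>

datatype colour = Black | White

text \<open>The half-edges of the medial graph correspond to the flags of \<open>G\<close>: the half-edge \<open>p\<close> leaves
  the medial vertex of the edge of \<open>G\<close> through \<open>p\<close> towards the corner of \<open>G\<close> between \<open>p\<close> and \<open>arc G p\<close>,
  and the medial edge in this corner consists of the half-edges \<open>p\<close> and \<open>arc G p\<close>. Around the medial
  vertex, two neighbouring half-edges are separated either by the half of the edge of \<open>G\<close> that runs
  to a vertex of \<open>G\<close> (these half-edges are matched by \<open>comm G\<close>) or by a face of \<open>G\<close> (these are
  matched by \<open>side G\<close>). As a ribbon graph, the medial graph has two flags \<open>(p, Black)\<close> and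
  \<open>(p, White)\<close> for each half-edge \<open>p\<close>, lying on the side of the vertex and on the side of the face of
  \<open>G\<close>, respectively. Isolated vertices of \<open>G\<close> have no corners and contribute nothing.\<close>

definition medial_graph :: "('f, 'v) ribbon \<Rightarrow> ('f \<times> colour, 'v) ribbon" where
  "medial_graph G =
     \<lparr>flags = flags G \<times> UNIV,
      comm = (\<lambda>(p, k). (p, case k of Black \<Rightarrow> White | White \<Rightarrow> Black)),
      side = (\<lambda>(p, k). (arc G p, k)),
      arc = (\<lambda>(p, k). (case k of Black \<Rightarrow> comm G p | White \<Rightarrow> side G p, k)),
      isolated = {}\<rparr>"

definition medial_vertex :: "'f set \<Rightarrow> ('f \<times> colour) set" where
  "medial_vertex e = e \<times> UNIV"

text \<open>The face of the medial graph which contains the vertex \<open>v\<close> of \<open>G\<close> is \<open>v \<times> {Black}\<close>.\<close>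

definition black_faces :: "('f, 'v) ribbon \<Rightarrow> ('f \<times> colour) set set" where
  "black_faces G = (\<lambda>v. v \<times> {Black}) ` vertices G"

text \<open>Half-edges of a ribbon graph are identified with common line segments, and an orientation of
  the edges is given by the set of half-edges that are directed away from their vertex.\<close>

definition half_edge :: "('f, 'v) ribbon \<Rightarrow> 'f \<Rightarrow> 'f set" where
  "half_edge M q = {q, comm M q}"

definition direction :: "('f, 'v) ribbon \<Rightarrow> 'f set set \<Rightarrow> bool" where
  "direction M D \<longleftrightarrow>
     D \<subseteq> half_edge M ` flags M \<and>
     (\<forall>q\<in>flags M. half_edge M q \<in> D \<longleftrightarrow> half_edge M (side M q) \<notin> D)"

text \<open>\<open>turn\<close> goes on to the next half-edge in the cyclic order around a vertex.\<close>

definition turn :: "('f, 'v) ribbon \<Rightarrow> 'f \<Rightarrow> 'f" where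
  "turn M q = arc M (comm M q)"

definition all_crossing_direction :: "('f, 'v) ribbon \<Rightarrow> 'f set set \<Rightarrow> bool" where
  "all_crossing_direction M D \<longleftrightarrow>
     direction M D \<and>
     (\<forall>v\<in>vertices M. \<exists>q\<in>v.
        half_edge M q \<notin> D \<and>
        half_edge M (turn M q) \<notin> D \<and>
        half_edge M (turn M (turn M q)) \<in> D \<and>
        half_edge M (turn M (turn M (turn M q))) \<in> D)"

text \<open>The corners at a vertex \<open>w\<close> are the pairs \<open>q\<close>, \<open>arc M q\<close> for \<open>q \<in> w\<close>; such a corner is bounded by
  the half-edges of \<open>q\<close> and of \<open>arc M q\<close>, and belongs to the face through \<open>q\<close>.\<close>

definition c_vertex :: "('f, 'v) ribbon \<Rightarrow> ('f \<times> colour) set set \<Rightarrow> ('f \<times> colour) set \<Rightarrow> bool" where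
  "c_vertex G D w \<longleftrightarrow>
     (\<exists>q\<in>w. face_at (medial_graph G) q \<in> black_faces G \<and>
        half_edge (medial_graph G) q \<notin> D \<and>
        half_edge (medial_graph G) (arc (medial_graph G) q) \<notin> D)"

definition c_edges :: "('f, 'v) ribbon \<Rightarrow> ('f \<times> colour) set set \<Rightarrow> 'f set set" where
  "c_edges G D = {e \<in> edges G. c_vertex G D (medial_vertex e)}"


section \<open>Well-definedness\<close>

lemma orbit_refl: "p \<in> orbit s t p"
  by (simp add: orbit_def)

lemma orbit_step1: "q \<in> orbit s t p \<Longrightarrow> s q \<in> orbit s t p"
  by (auto simp: orbit_def intro: rtranclp.rtrancl_into_rtrancl)

lemma orbit_step2: "q \<in> orbit s t p \<Longrightarrow> t q \<in> orbit s t p"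
  by (auto simp: orbit_def intro: rtranclp.rtrancl_into_rtrancl)

lemma orbit_least:
  assumes "p \<in> X" "\<And>x. x \<in> X \<Longrightarrow> s x \<in> X" "\<And>x. x \<in> X \<Longrightarrow> t x \<in> X"
  shows "orbit s t p \<subseteq> X"
proof
  fix q assume "q \<in> orbit s t p"
  then have "(\<lambda>x y. y = s x \<or> y = t x)\<^sup>*\<^sup>* p q" by (simp add: orbit_def)
  then show "q \<in> X" by induction (use assms in auto)
qed

lemma orbit_commute: "orbit s t p = orbit t s p"
  by (simp add: orbit_def disj_commute)

lemma orbit_map:
  assumes "\<And>x. s' (f x) = f (s x)" "\<And>x. t' (f x) = f (t x)"
  shows "orbit s' t' (f p) = f ` orbit s t p"
proof
  show "orbit s' t' (f p) \<subseteq> f ` orbit s t p"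
    by (rule orbit_least) (auto simp: assms intro: orbit_refl orbit_step1 orbit_step2)
  have "orbit s t p \<subseteq> {x. f x \<in> orbit s' t' (f p)}"
    by (rule orbit_least)
      (auto simp: assms[symmetric] intro: orbit_refl orbit_step1 orbit_step2)
  then show "f ` orbit s t p \<subseteq> orbit s' t' (f p)" by blast
qed

lemma ribbon_of_two_arrows:
  assumes lab: "\<And>x y l. (x, y, l) \<in> arrows P \<Longrightarrow> x = p \<or> y = p \<Longrightarrow> l = e"
    and two: "\<And>x y. (x, y, e) \<in> arrows P \<longleftrightarrow> (x, y) = (u, w) \<or> (x, y) = (u', w')"
    and dist: "distinct [u, w, u', w']"
  shows "p = u \<Longrightarrow> comm (ribbon_of_arrows P) p = w"
    and "p = u \<Longrightarrow> side (ribbon_of_arrows P) p = w'"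
    and "p = w \<Longrightarrow> comm (ribbon_of_arrows P) p = u"
    and "p = w \<Longrightarrow> side (ribbon_of_arrows P) p = u'"
proof -
  have "(\<exists>l. (p, q, l) \<in> arrows P \<or> (q, p, l) \<in> arrows P) \<longleftrightarrow>
      (p, q, e) \<in> arrows P \<or> (q, p, e) \<in> arrows P" for q
    using lab by blast
  then have comm: "comm (ribbon_of_arrows P) p =
      (THE q. (p, q) = (u, w) \<or> (p, q) = (u', w') \<or> (q, p) = (u, w) \<or> (q, p) = (u', w'))"
    by (simp add: ribbon_of_arrows_def two disj_assoc)
  have "(\<exists>t h l. (t, p, l) \<in> arrows P \<and> (q, h, l) \<in> arrows P \<and> (t, p) \<noteq> (q, h) \<or>
        (p, h, l) \<in> arrows P \<and> (t, q, l) \<in> arrows P \<and> (p, h) \<noteq> (t, q)) \<longleftrightarrow>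
      (\<exists>t h. (t, p, e) \<in> arrows P \<and> (q, h, e) \<in> arrows P \<and> (t, p) \<noteq> (q, h) \<or>
        (p, h, e) \<in> arrows P \<and> (t, q, e) \<in> arrows P \<and> (p, h) \<noteq> (t, q))" for q
    using lab by blast
  then have side: "side (ribbon_of_arrows P) p =
      (THE q. \<exists>t h. ((t, p) = (u, w) \<or> (t, p) = (u', w')) \<and>
          ((q, h) = (u, w) \<or> (q, h) = (u', w')) \<and> (t, p) \<noteq> (q, h) \<or>
        ((p, h) = (u, w) \<or> (p, h) = (u', w')) \<and>
          ((t, q) = (u, w) \<or> (t, q) = (u', w')) \<and> (p, h) \<noteq> (t, q))"
    by (simp only: ribbon_of_arrows_def two ribbon.simps)
  show "p = u \<Longrightarrow> comm (ribbon_of_arrows P) p = w"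
    and "p = w \<Longrightarrow> comm (ribbon_of_arrows P) p = u"
    unfolding comm using dist by (auto intro!: the_equality)
  show "p = u \<Longrightarrow> side (ribbon_of_arrows P) p = w'"
    and "p = w \<Longrightarrow> side (ribbon_of_arrows P) p = u'"
    unfolding side using dist by (auto intro!: the_equality)
qed

context ribbon_graph
begin

lemma flag_simps [simp]:
  assumes "p \<in> flags G"
  shows "comm G p \<in> flags G" "comm G p \<noteq> p" "comm G (comm G p) = p"
    "side G p \<in> flags G" "side G p \<noteq> p" "side G (side G p) = p"
    "arc G p \<in> flags G" "arc G p \<noteq> p" "arc G (arc G p) = p"
    "comm G (side G p) = side G (comm G p)"
    "comm G p \<noteq> side G p" "side G p \<noteq> comm G p"
    "side G (comm G p) \<noteq> p" "p \<noteq> side G (comm G p)"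
    "p \<noteq> comm G p" "p \<noteq> side G p" "p \<noteq> arc G p"
proof -
  have c: "comm G q \<in> flags G \<and> comm G q \<noteq> q \<and> comm G (comm G q) = q"
    and s: "side G q \<in> flags G \<and> side G q \<noteq> q \<and> side G (side G q) = q"
    and a: "arc G q \<in> flags G \<and> arc G q \<noteq> q \<and> arc G (arc G q) = q" if "q \<in> flags G" for q
    using that comm side arc by (simp_all add: matching_on_def)
  have "side G (comm G p) \<noteq> p"
    using c[OF assms] s[of "comm G p"] comm_neq_side[OF assms] by metis
  with c[OF assms] s[OF assms] a[OF assms] comm_side[OF assms] comm_neq_side[OF assms]
  show "comm G p \<in> flags G" "comm G p \<noteq> p" "comm G (comm G p) = p"
    "side G p \<in> flags G" "side G p \<noteq> p" "side G (side G p) = p"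
    "arc G p \<in> flags G" "arc G p \<noteq> p" "arc G (arc G p) = p"
    "comm G (side G p) = side G (comm G p)"
    "comm G p \<noteq> side G p" "side G p \<noteq> comm G p"
    "side G (comm G p) \<noteq> p" "p \<noteq> side G (comm G p)"
    "p \<noteq> comm G p" "p \<noteq> side G p" "p \<noteq> arc G p"
    by metis+
qed

lemma edge_at_eq:
  assumes "p \<in> flags G"
  shows "edge_at G p = {p, comm G p, side G p, side G (comm G p)}"
proof
  show "edge_at G p \<subseteq> {p, comm G p, side G p, side G (comm G p)}"
    unfolding edge_at_def by (rule orbit_least) (use assms in auto)
  show "{p, comm G p, side G p, side G (comm G p)} \<subseteq> edge_at G p"
    unfolding edge_at_def by (auto intro: orbit_refl orbit_step1 orbit_step2)
qed

lemma edge_at_comm: "p \<in> flags G \<Longrightarrow> edge_at G (comm G p) = edge_at G p"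
  by (auto simp: edge_at_eq)

lemma edge_at_side: "p \<in> flags G \<Longrightarrow> edge_at G (side G p) = edge_at G p"
  by (auto simp: edge_at_eq)

lemma edge_orientation_exists: "\<exists>T. edge_orientation G T"
proof -
  define r where "r p = (SOME q. q \<in> edge_at G p)" for p
  define T where "T = {p \<in> flags G. r p = p \<or> r p = side G (comm G p)}"
  have r: "r p \<in> {p, comm G p, side G p, side G (comm G p)}" if "p \<in> flags G" for p
    using someI[of "\<lambda>q. q \<in> edge_at G p" p] orbit_refl[of p "comm G" "side G"]
    unfolding r_def edge_at_eq[OF that, symmetric] by (simp add: edge_at_def)
  have rc: "r (comm G p) = r p" "r (side G p) = r p" if "p \<in> flags G" for p
    using that by (simp_all add: r_def edge_at_comm edge_at_side)
  have "edge_orientation G T"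
    unfolding edge_orientation_def
  proof
    fix p assume p: "p \<in> flags G"
    have "side G (comm G p) \<noteq> comm G p" "side G (comm G p) \<noteq> side G p"
      using p flag_simps(5)[of "comm G p"] flag_simps(2)[of "side G p"] by simp_all
    then show "(p \<in> T \<longleftrightarrow> comm G p \<notin> T) \<and> (p \<in> T \<longleftrightarrow> side G p \<notin> T)"
      using r[OF p] p flag_simps(16)[of "comm G p"] by (auto simp: T_def rc)
  qed
  then show ?thesis by blast
qed

text \<open>The partial dual does not depend on the choice of the orientation.\<close>

lemma ribbon_of_partial_dual_arrows:
  assumes T: "edge_orientation G T" and p: "p \<in> flags G"
  shows "comm (ribbon_of_arrows (partial_dual_arrows G A T)) p =
           (if edge_at G p \<in> A then side G p else comm G p)"
    and "side (ribbon_of_arrows (partial_dual_arrows G A T)) p =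
           (if edge_at G p \<in> A then comm G p else side G p)"
proof -
  let ?P = "partial_dual_arrows G A T"
  have R: "(x, y, l) \<in> arrows ?P \<longleftrightarrow> x \<in> flags G \<and> l = edge_at G x \<and>
      (if l \<in> A then x \<notin> T \<and> y = side G x else x \<in> T \<and> y = comm G x)" for x y l
    unfolding partial_dual_arrows_def by (simp, blast)
  have Tc: "comm G x \<in> T \<longleftrightarrow> x \<notin> T" "side G x \<in> T \<longleftrightarrow> x \<notin> T" if "x \<in> flags G" for x
    using T that unfolding edge_orientation_def by blast+
  have same: "x \<in> flags G \<and> edge_at G x = edge_at G p \<longleftrightarrow>
      x = p \<or> x = comm G p \<or> x = side G p \<or> x = side G (comm G p)" for x
  proof
    assume x: "x \<in> flags G \<and> edge_at G x = edge_at G p"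
    then have "x \<in> edge_at G p" using edge_at_eq[of x] by blast
    then show "x = p \<or> x = comm G p \<or> x = side G p \<or> x = side G (comm G p)"
      by (simp add: edge_at_eq[OF p])
  qed (use p in \<open>elim disjE; simp add: edge_at_comm edge_at_side\<close>)
  have label: "l = edge_at G p" if "(x, y, l) \<in> arrows ?P" "x = p \<or> y = p" for x y l
    using that edge_at_comm[of x] edge_at_side[of x] by (simp add: R split: if_splits) metis+
  have tails: "(x, y, edge_at G p) \<in> arrows ?P \<longleftrightarrow>
      (x = p \<or> x = comm G p \<or> x = side G p \<or> x = side G (comm G p)) \<and>
      (if edge_at G p \<in> A then x \<notin> T \<and> y = side G x else x \<in> T \<and> y = comm G x)" for x y
    unfolding R same[symmetric] by metis
  have d: "distinct [p, comm G p, side G p, side G (comm G p)]"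
    using p flag_simps(5)[of "comm G p"] flag_simps(2)[of "side G p"] by simp
  have "comm (ribbon_of_arrows ?P) p = (if edge_at G p \<in> A then side G p else comm G p) \<and>
      side (ribbon_of_arrows ?P) p = (if edge_at G p \<in> A then comm G p else side G p)"
  proof (cases "edge_at G p \<in> A")
    case A: True
    show ?thesis
    proof (cases "p \<in> T")
      case True
      have "(x, y, edge_at G p) \<in> arrows ?P \<longleftrightarrow>
          (x, y) = (side G p, p) \<or> (x, y) = (comm G p, side G (comm G p))" for x y
        unfolding tails using A True p d Tc by auto
      from ribbon_of_two_arrows(3,4)[OF label this _ refl] show ?thesis using A d by auto
    next
      case False
      have "(x, y, edge_at G p) \<in> arrows ?P \<longleftrightarrow>
          (x, y) = (p, side G p) \<or> (x, y) = (side G (comm G p), comm G p)" for x y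
        unfolding tails using A False p d Tc by auto
      from ribbon_of_two_arrows(1,2)[OF label this _ refl] show ?thesis using A d by auto
    qed
  next
    case A: False
    show ?thesis
    proof (cases "p \<in> T")
      case True
      have "(x, y, edge_at G p) \<in> arrows ?P \<longleftrightarrow>
          (x, y) = (p, comm G p) \<or> (x, y) = (side G (comm G p), side G p)" for x y
        unfolding tails using A True p d Tc by auto
      from ribbon_of_two_arrows(1,2)[OF label this _ refl] show ?thesis using A d by auto
    next
      case False
      have "(x, y, edge_at G p) \<in> arrows ?P \<longleftrightarrow>
          (x, y) = (comm G p, p) \<or> (x, y) = (side G p, side G (comm G p))" for x y
        unfolding tails using A False p d Tc by auto
      from ribbon_of_two_arrows(3,4)[OF label this _ refl] show ?thesis using A d by auto
    qed
  qed
  then show "comm (ribbon_of_arrows ?P) p = (if edge_at G p \<in> A then side G p else comm G p)"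
    and "side (ribbon_of_arrows ?P) p = (if edge_at G p \<in> A then comm G p else side G p)"
    by blast+
qed

lemma partial_dual_simps:
  shows "flags (partial_dual G A) = flags G"
    and "arc (partial_dual G A) = arc G"
    and "isolated (partial_dual G A) = isolated G"
    and "p \<in> flags G \<Longrightarrow>
           comm (partial_dual G A) p = (if edge_at G p \<in> A then side G p else comm G p)"
    and "p \<in> flags G \<Longrightarrow>
           side (partial_dual G A) p = (if edge_at G p \<in> A then comm G p else side G p)"
  using someI_ex[OF edge_orientation_exists]
  by (simp_all add: partial_dual_def ribbon_of_partial_dual_arrows)
     (simp_all add: ribbon_of_arrows_def partial_dual_arrows_def)

lemma ribbon_graph_partial_dual: "ribbon_graph (partial_dual G A)"
  using finite_flags finite_isolated
  by unfold_locales
    (auto simp: matching_on_def partial_dual_simps edge_at_comm edge_at_side)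

lemma edges_partial_dual: "edges (partial_dual G A) = edges G"
proof -
  interpret D: ribbon_graph "partial_dual G A" by (rule ribbon_graph_partial_dual)
  have "edge_at (partial_dual G A) p = edge_at G p" if "p \<in> flags G" for p
    using that
    by (subst D.edge_at_eq; cases "edge_at G p \<in> A")
      (auto simp: partial_dual_simps edge_at_comm edge_at_side edge_at_eq[OF that])
  then show ?thesis by (simp add: edges_def partial_dual_simps)
qed

lemma ribbon_graph_medial_graph: "ribbon_graph (medial_graph G)"
proof -
  have UNIV_colour: "(UNIV :: colour set) = {Black, White}"
    using colour.exhaust by blast
  have "finite (UNIV :: colour set)" by (subst UNIV_colour) simp
  then show ?thesis
    using finite_flags
    by unfold_locales
      (auto simp: matching_on_def medial_graph_def split: colour.splits)
qed

lemma vertices_medial_graph: "vertices (medial_graph G) = medial_vertex ` edges G"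
proof -
  let ?M = "medial_graph G"
  have "vertex_at ?M (p, k) = medial_vertex (edge_at G p)" if p: "p \<in> flags G" for p k
  proof
    show "vertex_at ?M (p, k) \<subseteq> medial_vertex (edge_at G p)"
      unfolding vertex_at_def
      by (rule orbit_least)
        (auto simp: medial_vertex_def edge_at_def medial_graph_def
          intro: orbit_refl orbit_step1 orbit_step2 split: colour.splits)
    have flip: "(x, k') \<in> vertex_at ?M (p, k)" if "(x, l) \<in> vertex_at ?M (p, k)" for x k' l
      using that orbit_step1[of "(x, l)" "comm ?M" "arc ?M" "(p, k)"]
      unfolding vertex_at_def by (cases k'; cases l) (auto simp: medial_graph_def)
    have "edge_at G p \<subseteq> {x. (x, Black) \<in> vertex_at ?M (p, k)}"
      unfolding edge_at_def
    proof (rule orbit_least)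
      show "p \<in> {x. (x, Black) \<in> vertex_at ?M (p, k)}"
        using flip[of p k] by (simp add: vertex_at_def orbit_refl)
    next
      fix x assume "x \<in> {x. (x, Black) \<in> vertex_at ?M (p, k)}"
      then have x: "(x, l) \<in> vertex_at ?M (p, k)" for l using flip by blast
      have "arc ?M (x, l) \<in> vertex_at ?M (p, k)" for l
        using x unfolding vertex_at_def by (rule orbit_step2)
      from this[of Black] this[of White]
      show "comm G x \<in> {x. (x, Black) \<in> vertex_at ?M (p, k)}"
        "side G x \<in> {x. (x, Black) \<in> vertex_at ?M (p, k)}"
        using flip by (auto simp: medial_graph_def)
    qed
    then show "medial_vertex (edge_at G p) \<subseteq> vertex_at ?M (p, k)"
      using flip by (auto simp: medial_vertex_def)
  qed
  moreover have "flags ?M = flags G \<times> UNIV" by (simp add: medial_graph_def)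
  ultimately show ?thesis unfolding vertices_def edges_def by (auto simp: image_iff)
qed

lemma face_at_medial_graph:
  "face_at (medial_graph G) (p, Black) = vertex_at G p \<times> {Black}"
  "face_at (medial_graph G) (p, White) = face_at G p \<times> {White}"
proof -
  have "orbit (arc (medial_graph G)) (side (medial_graph G)) (p, Black) =
      (\<lambda>x. (x, Black)) ` orbit (comm G) (arc G) p"
    by (rule orbit_map) (simp_all add: medial_graph_def)
  then show "face_at (medial_graph G) (p, Black) = vertex_at G p \<times> {Black}"
    by (auto simp: face_at_def vertex_at_def)
  have "orbit (arc (medial_graph G)) (side (medial_graph G)) (p, White) =
      (\<lambda>x. (x, White)) ` orbit (side G) (arc G) p"
    by (rule orbit_map) (simp_all add: medial_graph_def)
  then show "face_at (medial_graph G) (p, White) = face_at G p \<times> {White}"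
    by (auto simp: face_at_def orbit_commute[of "side G"])
qed

lemma faces_medial_graph:
  "faces (medial_graph G) = black_faces G \<union> (\<lambda>f. f \<times> {White}) ` faces G"
proof -
  have "flags (medial_graph G) = (\<lambda>p. (p, Black)) ` flags G \<union> (\<lambda>p. (p, White)) ` flags G"
    using colour.exhaust by (auto simp: medial_graph_def image_iff)
  then show ?thesis
    by (simp add: faces_def black_faces_def vertices_def image_Un image_image face_at_medial_graph)
qed

end

end

theory Submission
  imports Defs
begin

text \<open>Write \<open>c\<close>, \<open>s\<close>, \<open>a\<close> for the matchings of the flags by common line segments, edge line segments
  and arcs. The partial dual swaps \<open>c\<close> and \<open>s\<close> on the edges in \<open>A\<close> and keeps \<open>a\<close>; let \<open>c'\<close>, \<open>s'\<close> be
  the swapped matchings. The partial dual is bipartite iff its vertices have a proper 2-colouring, that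
  is, iff some 2-colouring of the flags is constant along \<open>c'\<close> and \<open>a\<close> and changes along \<open>s'\<close>. An
  all-crossing direction with set of \<open>c\<close>-edges \<open>A\<close> is a 2-colouring of the flags (in, out) that is
  constant along \<open>s'\<close> and changes along \<open>c'\<close> and \<open>a\<close>. An orientation of \<open>G\<close> is a 2-colouring of the
  flags that changes along \<open>c\<close>, \<open>s\<close> and \<open>a\<close>, so adding it exchanges the two kinds of colourings.\<close>

section \<open>Bipartite graphs and 2-colourings\<close>

text \<open>The edge set is a separate argument so that edges can be added one by one. A loop at
  \<open>u\<close> fits the pattern with \<open>w = u\<close>, so no colouring is proper on
  it.\<close>

definition proper_on :: "('v, 'e) multigraph \<Rightarrow> 'e set \<Rightarrow> ('v \<Rightarrow> bool) \<Rightarrow> bool" where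
  "proper_on H E \<kappa> \<longleftrightarrow> (\<forall>e\<in>E. \<forall>u w. ends H e = {u, w} \<longrightarrow> \<kappa> u \<noteq> \<kappa> w)"

definition is_path :: "('v, 'e) multigraph \<Rightarrow> 'e set \<Rightarrow> 'v list \<Rightarrow> 'e list \<Rightarrow> bool" where
  "is_path H E vs es \<longleftrightarrow>
     length vs = Suc (length es) \<and> distinct vs \<and> set es \<subseteq> E \<and>
     (\<forall>i < length es. ends H (es ! i) = {vs ! i, vs ! Suc i})"

definition adjacent :: "('v, 'e) multigraph \<Rightarrow> 'e set \<Rightarrow> 'v \<Rightarrow> 'v \<Rightarrow> bool" where
  "adjacent H E x y \<longleftrightarrow> (\<exists>e\<in>E. ends H e = {x, y})"

text \<open>A repeated edge would bring vertex \<open>i\<close> back at position \<open>j\<close> or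
  \<open>Suc j\<close>, against the distinctness of the vertices.\<close>

lemma is_path_distinct_edges:
  assumes "is_path H E vs es"
  shows "distinct es"
proof -
  have "es ! i \<noteq> es ! j" if "i < j" "j < length es" for i j
  proof
    assume "es ! i = es ! j"
    then have "{vs ! i, vs ! Suc i} = {vs ! j, vs ! Suc j}"
      using assms that unfolding is_path_def by (metis order.strict_trans)
    then have "vs ! i = vs ! j \<or> vs ! i = vs ! Suc j" by blast
    then show False
      using assms that by (auto simp: is_path_def nth_eq_iff_index_eq)
  qed
  then show ?thesis
    unfolding distinct_conv_nth by (metis nat_neq_iff)
qed

text \<open>Induction along the walk: a new vertex extends the path, and a return to a vertex
  already on it cuts the path back to that vertex.\<close>

lemma is_path_of_adjacent:
  assumes "(adjacent H E)\<^sup>*\<^sup>* u w"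
  shows "\<exists>vs es. is_path H E vs es \<and> vs ! 0 = u \<and> vs ! length es = w"
  using assms
proof induction
  case base
  have "is_path H E [u] []" by (simp add: is_path_def)
  then show ?case by force
next
  case (step y z)
  then obtain vs es where p: "is_path H E vs es" "vs ! 0 = u" "vs ! length es = y" by blast
  obtain e where e: "e \<in> E" "ends H e = {y, z}" using step by (auto simp: adjacent_def)
  show ?case
  proof (cases "z \<in> set vs")
    case True
    then obtain k where k: "k < length vs" "vs ! k = z" by (auto simp: in_set_conv_nth)
    have "is_path H E (take (Suc k) vs) (take k es)"
      using p(1) k set_take_subset[of k es] by (auto simp: is_path_def)
    moreover have "length (take k es) = k" using p(1) k by (simp add: is_path_def)
    ultimately show ?thesis using p(2) k
      by (intro exI[of _ "take (Suc k) vs"] exI[of _ "take k es"]) simp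
  next
    case False
    have "is_path H E (vs @ [z]) (es @ [e])"
      using p e False by (auto simp: is_path_def nth_append less_Suc_eq)
    moreover have "(vs @ [z]) ! 0 = u" "(vs @ [z]) ! length (es @ [e]) = z"
      using p by (auto simp: is_path_def nth_append)
    ultimately show ?thesis by blast
  qed
qed

lemma alternating_colours:
  fixes \<kappa> :: "'v \<Rightarrow> bool"
  assumes "\<And>i. i < n \<Longrightarrow> \<kappa> (vs ! i) \<noteq> \<kappa> (vs ! Suc i)" and "i \<le> n"
  shows "\<kappa> (vs ! i) = (\<kappa> (vs ! 0) = even i)"
  using assms(2)
proof (induction i)
  case (Suc i)
  then show ?case using assms(1)[of i] by auto
qed simp

text \<open>Colours alternate along a cycle, so for odd length its first and last vertices have
  equal colours, although the closing edge joins them.\<close>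

lemma bipartite_if_proper:
  assumes "proper_on H (edgs H) \<kappa>"
  shows "bipartite H"
  unfolding bipartite_def
proof (intro notI, elim exE conjE)
  fix vs es assume c: "is_cycle H vs es" and odd: "odd (length es)"
  then obtain n where n: "length es = Suc n" by (metis length_0_conv is_cycle_def not0_implies_Suc)
  have edge: "\<kappa> (vs ! i) \<noteq> \<kappa> (vs ! (Suc i mod Suc n))" if "i < Suc n" for i
  proof -
    have "es ! i \<in> edgs H" "ends H (es ! i) = {vs ! i, vs ! (Suc i mod Suc n)}"
      using c that n nth_mem[of i es] by (auto simp: is_cycle_def)
    then show ?thesis using assms unfolding proper_on_def by blast
  qed
  have "\<kappa> (vs ! n) = (\<kappa> (vs ! 0) = even n)"
  proof (rule alternating_colours[of n])
    fix i assume "i < n"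
    then show "\<kappa> (vs ! i) \<noteq> \<kappa> (vs ! Suc i)" using edge[of i] by simp
  qed simp
  then show False using edge[of n] odd n by simp
qed

text \<open>Edges are inserted one at a time. If the new edge joins \<open>u\<close> and
  \<open>w\<close> of equal colour, the colours are swapped on the component of \<open>u\<close>. It
  misses \<open>w\<close>: a path from \<open>u\<close> to \<open>w\<close> would have even length,
  and the new edge would close it to an odd cycle.\<close>

lemma proper_if_bipartite:
  assumes bip: "bipartite H" and "finite (edgs H)"
    and ends: "\<And>e. e \<in> edgs H \<Longrightarrow> \<exists>u w. ends H e = {u, w}"
    and verts: "\<And>e. e \<in> edgs H \<Longrightarrow> ends H e \<subseteq> verts H"
  shows "\<exists>\<kappa>. proper_on H (edgs H) \<kappa>"
proof -
  have "\<exists>\<kappa>. proper_on H E \<kappa>" if "finite E" "E \<subseteq> edgs H" for E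
    using that
  proof (induction E rule: finite_induct)
    case empty
    show ?case by (simp add: proper_on_def)
  next
    case (insert e E)
    then obtain \<kappa> where \<kappa>: "proper_on H E \<kappa>" by blast
    obtain u w where e: "ends H e = {u, w}" using ends insert.prems by blast
    show ?case
    proof (cases "\<kappa> u = \<kappa> w")
      case False
      then have "proper_on H (insert e E) \<kappa>"
        using \<kappa> e by (auto simp: proper_on_def doubleton_eq_iff)
      then show ?thesis by blast
    next
      case same: True
      define C where "C = {x. (adjacent H E)\<^sup>*\<^sup>* u x}"
      have "w \<notin> C"
      proof
        assume "w \<in> C"
        then obtain vs es where p: "is_path H E vs es" "vs ! 0 = u" "vs ! length es = w"
          using is_path_of_adjacent[of H E u w] by (auto simp: C_def)
        have len: "length vs = Suc (length es)" and sub: "set es \<subseteq> E"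
          using p(1) by (auto simp: is_path_def)
        have step: "ends H (es ! i) = {vs ! i, vs ! Suc i}" if "i < length es" for i
          using p(1) that by (simp add: is_path_def)
        have "\<kappa> (vs ! length es) = (\<kappa> (vs ! 0) = even (length es))"
        proof (rule alternating_colours[of "length es"])
          fix i assume i: "i < length es"
          then have "es ! i \<in> E" using sub nth_mem by blast
          then show "\<kappa> (vs ! i) \<noteq> \<kappa> (vs ! Suc i)"
            using step[OF i] \<kappa> unfolding proper_on_def by blast
        qed simp
        then have even: "even (length es)" using p same by (cases "\<kappa> w") auto
        \<comment> \<open>The edge \<open>e\<close>, at index \<open>length es\<close>, runs from
          the end \<open>w\<close> of the path back to its start \<open>u\<close>. For a loop the
          path has no edges and \<open>e\<close> alone is the cycle.\<close>
        have edge: "ends H ((es @ [e]) ! i) = {vs ! i, vs ! (Suc i mod length (es @ [e]))}"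
          if "i < length (es @ [e])" for i
        proof (cases "i < length es")
          case True
          then show ?thesis using step[of i] by (simp add: nth_append)
        next
          case False
          then have "i = length es" using that by simp
          then show ?thesis using e p(2,3) by (auto simp: nth_append)
        qed
        \<comment> \<open>Every vertex of the path is an end of some edge of the closed cycle, even
          when the path has no edges.\<close>
        have vs: "set vs \<subseteq> verts H"
        proof
          fix x assume "x \<in> set vs"
          then obtain i where i: "i < length (es @ [e])" "x = vs ! i"
            using len by (auto simp: in_set_conv_nth)
          have "(es @ [e]) ! i \<in> set (es @ [e])" using i(1) by (rule nth_mem)
          then have "(es @ [e]) ! i \<in> edgs H"
            using sub insert.prems by auto
          then show "x \<in> verts H" using edge[OF i(1)] verts i(2) by blast
        qed
        have "is_cycle H vs (es @ [e])"
          unfolding is_cycle_def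
        proof (intro conjI)
          show "distinct (es @ [e])"
            using is_path_distinct_edges[OF p(1)] sub insert.hyps by auto
          show "distinct vs" using p(1) by (simp add: is_path_def)
          show "set (es @ [e]) \<subseteq> edgs H" using sub insert.prems by auto
        qed (use len vs edge in auto)
        then show False using bip even unfolding bipartite_def by fastforce
      qed
      moreover have "u \<in> C" by (simp add: C_def)
      moreover have "x \<in> C \<longleftrightarrow> y \<in> C" if "f \<in> E" "ends H f = {x, y}" for f x y
      proof -
        have "adjacent H E x y" "adjacent H E y x"
          using that by (auto simp: adjacent_def insert_commute)
        then show ?thesis
          unfolding C_def by (auto intro: rtranclp.rtrancl_into_rtrancl)
      qed
      \<comment> \<open>Edges of \<open>E\<close> stay proper, since their ends lie both inside or
        both outside \<open>C\<close>; exactly one end of \<open>e\<close> changes colour.\<close>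
      ultimately have "proper_on H (insert e E) (\<lambda>x. \<kappa> x \<noteq> (x \<in> C))"
        using \<kappa> e same unfolding proper_on_def by (metis doubleton_eq_iff insert_iff)
      then show ?thesis by blast
    qed
  qed
  then show ?thesis using assms(2) by blast
qed

section \<open>Colourings of the flags\<close>

lemma orbit_shift:
  assumes "s (s p) = p" "t (t p) = p"
  shows "orbit s t (s p) = orbit s t p" "orbit s t (t p) = orbit s t p"
proof -
  have "p \<in> orbit s t (s p)" "p \<in> orbit s t (t p)"
    using orbit_step1[OF orbit_refl[of "s p" s t]] orbit_step2[OF orbit_refl[of "t p" s t]] assms
    by simp_all
  then show "orbit s t (s p) = orbit s t p" "orbit s t (t p) = orbit s t p"
    by (intro equalityI orbit_least; auto intro: orbit_refl orbit_step1 orbit_step2)+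
qed

context ribbon_graph
begin

lemma vertex_at_shift:
  assumes "p \<in> flags G"
  shows "vertex_at G (comm G p) = vertex_at G p" "vertex_at G (arc G p) = vertex_at G p"
  using assms by (simp_all add: vertex_at_def orbit_shift)

text \<open>\<open>comm\<close> stays on one vertex disc, so among the four flags of the edge
  \<open>p\<close> and \<open>side G p\<close> already give both ends.\<close>

lemma ends_edge_at:
  assumes "p \<in> flags G"
  shows "ends (underlying_graph G) (edge_at G p) =
    {Inl (vertex_at G p), Inl (vertex_at G (side G p))}"
  using assms vertex_at_shift(1)[of "side G p"]
  by (auto simp: underlying_graph_def edge_at_eq vertex_at_shift)

text \<open>Non-isolated vertices are orbits of \<open>comm\<close> and \<open>arc\<close>, so
  colouring them means colouring flags constantly along these two; \<open>side\<close> leads from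
  one end of an edge to the other.\<close>

lemma bipartite_iff_flag_colouring:
  "bipartite (underlying_graph G) \<longleftrightarrow>
    (\<exists>\<kappa>. \<forall>p\<in>flags G. \<kappa> (comm G p) = \<kappa> p \<and> \<kappa> (arc G p) = \<kappa> p \<and> \<kappa> (side G p) = (\<not> \<kappa> p))"
  (is "_ \<longleftrightarrow> ?R")
proof
  have edgs: "edgs (underlying_graph G) = edge_at G ` flags G"
    by (simp add: underlying_graph_def edges_def)
  {
    assume bip: "bipartite (underlying_graph G)"
    have "\<exists>\<kappa>. proper_on (underlying_graph G) (edgs (underlying_graph G)) \<kappa>"
    proof (rule proper_if_bipartite[OF bip])
      show "finite (edgs (underlying_graph G))" using finite_flags by (simp add: edgs)
      fix e assume "e \<in> edgs (underlying_graph G)"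
      then obtain p where p: "p \<in> flags G" "e = edge_at G p" by (auto simp: edgs)
      then show "\<exists>u w. ends (underlying_graph G) e = {u, w}" using ends_edge_at by blast
      show "ends (underlying_graph G) e \<subseteq> verts (underlying_graph G)"
        unfolding p(2) ends_edge_at[OF p(1)]
        using p(1) by (auto simp: underlying_graph_def vertices_def)
    qed
    then obtain \<kappa> where "proper_on (underlying_graph G) (edge_at G ` flags G) \<kappa>"
      unfolding edgs ..
    then have "\<kappa> (Inl (vertex_at G (side G p))) = (\<not> \<kappa> (Inl (vertex_at G p)))"
      if "p \<in> flags G" for p
      using ends_edge_at[OF that] that by (auto simp: proper_on_def)
    then show ?R by (intro exI[of _ "\<lambda>p. \<kappa> (Inl (vertex_at G p))"]) (auto simp: vertex_at_shift)
  }
  assume ?R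
  then obtain \<kappa> where \<kappa>: "\<forall>p\<in>flags G.
      \<kappa> (comm G p) = \<kappa> p \<and> \<kappa> (arc G p) = \<kappa> p \<and> \<kappa> (side G p) = (\<not> \<kappa> p)" ..
  \<comment> \<open>\<open>\<kappa>\<close> is constant on each vertex orbit, so any flag decides
    the colour. Isolated vertices meet no edge and get the default \<open>False\<close>.\<close>
  define K where "K v = (case v of Inl v \<Rightarrow> \<exists>q\<in>v. \<kappa> q | Inr _ \<Rightarrow> False)" for v :: "'f set + 'v"
  have K: "K (Inl (vertex_at G p)) = \<kappa> p" if "p \<in> flags G" for p
  proof -
    have "vertex_at G p \<subseteq> {q \<in> flags G. \<kappa> q = \<kappa> p}"
      unfolding vertex_at_def by (rule orbit_least) (use that \<kappa> in auto)
    moreover have "p \<in> vertex_at G p" by (simp add: vertex_at_def orbit_refl)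
    ultimately show ?thesis by (auto simp: K_def)
  qed
  have "proper_on (underlying_graph G) (edgs (underlying_graph G)) K"
    unfolding proper_on_def edgs
  proof (intro ballI allI impI)
    fix e u w assume "e \<in> edge_at G ` flags G" and e: "ends (underlying_graph G) e = {u, w}"
    then obtain p where p: "p \<in> flags G" "e = edge_at G p" by blast
    have "K (Inl (vertex_at G p)) \<noteq> K (Inl (vertex_at G (side G p)))"
      using p(1) \<kappa> by (simp add: K)
    moreover have "{u, w} = {Inl (vertex_at G p), Inl (vertex_at G (side G p))}"
      using e p by (simp add: ends_edge_at)
    ultimately show "K u \<noteq> K w" unfolding doubleton_eq_iff by blast
  qed
  then show "bipartite (underlying_graph G)" by (rule bipartite_if_proper)
qed

section \<open>All-crossing directions\<close>

lemma UNIV_colour: "(UNIV :: colour set) = {Black, White}"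
  using colour.exhaust by blast

lemma bex_medial_vertex:
  "(\<exists>x\<in>medial_vertex e. P x) \<longleftrightarrow> (\<exists>q\<in>e. P (q, Black) \<or> P (q, White))"
  by (auto simp: medial_vertex_def UNIV_colour)

text \<open>This identifies the half-edges of the medial graph with the flags of \<open>G\<close>,
  so that a direction becomes a 2-colouring of the flags.\<close>

lemma half_edge_medial_graph: "half_edge (medial_graph G) (p, k) = {p} \<times> UNIV"
  unfolding UNIV_colour by (cases k) (auto simp: half_edge_def medial_graph_def)

lemma turn_medial_graph:
  "turn (medial_graph G) (p, Black) = (side G p, White)"
  "turn (medial_graph G) (p, White) = (comm G p, Black)"
  by (simp_all add: turn_def medial_graph_def)

lemma direction_medial_graph:
  "direction (medial_graph G) D \<longleftrightarrow> D \<subseteq> (\<lambda>p. {p} \<times> UNIV) ` flags G \<and>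
    (\<forall>p\<in>flags G. {arc G p} \<times> UNIV \<in> D \<longleftrightarrow> {p} \<times> UNIV \<notin> D)"
proof -
  have flags: "flags (medial_graph G) = flags G \<times> UNIV" by (simp add: medial_graph_def)
  have "half_edge (medial_graph G) ` flags (medial_graph G) = (\<lambda>p. {p} \<times> UNIV) ` flags G"
  proof
    show "(\<lambda>p. {p} \<times> UNIV) ` flags G \<subseteq> half_edge (medial_graph G) ` flags (medial_graph G)"
      unfolding flags half_edge_medial_graph[of _ Black, symmetric] by blast
  qed (auto simp: flags half_edge_medial_graph)
  moreover have "half_edge (medial_graph G) (side (medial_graph G) (p, k)) = {arc G p} \<times> UNIV"
    for p k
    using half_edge_medial_graph[of "arc G p" k] by (simp add: medial_graph_def)
  ultimately show ?thesis
    unfolding direction_def by (auto simp: half_edge_medial_graph flags)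
qed

text \<open>A white face contains a flag coloured \<open>White\<close>, so it is no black face. Only
  flags \<open>(q, Black)\<close> can witness a c-vertex, and their corner lies between
  \<open>q\<close> and \<open>comm G q\<close>.\<close>

lemma c_vertex_medial_vertex:
  assumes p: "p \<in> flags G"
  shows "c_vertex G D (medial_vertex (edge_at G p)) \<longleftrightarrow>
    (\<exists>q\<in>edge_at G p. {q} \<times> UNIV \<notin> D \<and> {comm G q} \<times> UNIV \<notin> D)"
proof -
  have "face_at (medial_graph G) (q, White) \<notin> black_faces G" for q
  proof -
    have "q \<in> face_at G q" by (simp add: face_at_def orbit_refl)
    then show ?thesis by (auto simp: face_at_medial_graph black_faces_def)
  qed
  moreover have "face_at (medial_graph G) (q, Black) \<in> black_faces G" if "q \<in> edge_at G p" for q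
  proof -
    have "q \<in> flags G" using that p by (auto simp: edge_at_eq)
    then show ?thesis by (auto simp: face_at_medial_graph black_faces_def vertices_def)
  qed
  moreover have "arc (medial_graph G) (q, Black) = (comm G q, Black)" for q
    by (simp add: medial_graph_def)
  ultimately show ?thesis
    unfolding c_vertex_def bex_medial_vertex by (intro bex_cong) (simp_all add: half_edge_medial_graph)
qed

text \<open>From \<open>(q, Black)\<close> and from \<open>(q, White)\<close>, \<open>turn\<close>
  goes round the medial vertex in opposite senses, whence the disjunction. Either way the half-edge
  opposite to \<open>q\<close> is \<open>side G (comm G q)\<close>.\<close>

lemma crossing_medial_vertex:
  assumes p: "p \<in> flags G"
  shows "(\<exists>q\<in>medial_vertex (edge_at G p).
        half_edge (medial_graph G) q \<notin> D \<and>
        half_edge (medial_graph G) (turn (medial_graph G) q) \<notin> D \<and>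
        half_edge (medial_graph G) (turn (medial_graph G) (turn (medial_graph G) q)) \<in> D \<and>
        half_edge (medial_graph G)
          (turn (medial_graph G) (turn (medial_graph G) (turn (medial_graph G) q))) \<in> D) \<longleftrightarrow>
    (\<exists>q\<in>edge_at G p. {q} \<times> UNIV \<notin> D \<and> {side G (comm G q)} \<times> UNIV \<in> D \<and>
       ({side G q} \<times> UNIV \<notin> D \<and> {comm G q} \<times> UNIV \<in> D \<or>
        {comm G q} \<times> UNIV \<notin> D \<and> {side G q} \<times> UNIV \<in> D))"
proof -
  have "q \<in> flags G" if "q \<in> edge_at G p" for q
    using that p by (auto simp: edge_at_eq)
  then show ?thesis
    unfolding bex_medial_vertex turn_medial_graph half_edge_medial_graph by (intro bex_cong) auto
qed

text \<open>In the pattern in, in, out, out opposite half-edges have opposite directions. So exactly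
  one of \<open>comm\<close> and \<open>side\<close> pairs half-edges of equal direction:
  \<open>comm\<close> at a c-vertex, \<open>side\<close> at a d-vertex.\<close>

lemma c_edges_crossing_iff:
  assumes A: "A \<subseteq> edges G"
  shows "all_crossing_direction (medial_graph G) D \<and> A = c_edges G D \<longleftrightarrow>
    direction (medial_graph G) D \<and>
    (\<forall>p\<in>flags G.
      ({comm G p} \<times> UNIV \<in> D) = (({p} \<times> UNIV \<in> D) = (edge_at G p \<in> A)) \<and>
      ({side G p} \<times> UNIV \<in> D) = (({p} \<times> UNIV \<in> D) = (edge_at G p \<notin> A)))"
proof -
  define \<delta> where "\<delta> p \<longleftrightarrow> {p} \<times> UNIV \<in> D" for p
  define c where "c p \<longleftrightarrow> (\<exists>q\<in>edge_at G p. \<not> \<delta> q \<and> \<not> \<delta> (comm G q))" for p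
  define x where "x p \<longleftrightarrow> (\<exists>q\<in>edge_at G p. \<not> \<delta> q \<and> \<delta> (side G (comm G q)) \<and>
       (\<not> \<delta> (side G q) \<and> \<delta> (comm G q) \<or> \<not> \<delta> (comm G q) \<and> \<delta> (side G q)))" for p
  define r where "r p \<longleftrightarrow> \<delta> (comm G p) = (\<delta> p = (edge_at G p \<in> A)) \<and>
      \<delta> (side G p) = (\<delta> p = (edge_at G p \<notin> A))" for p
  have c: "c p \<longleftrightarrow> \<not> \<delta> p \<and> \<not> \<delta> (comm G p) \<or> \<not> \<delta> (side G p) \<and> \<not> \<delta> (side G (comm G p))"
    if "p \<in> flags G" for p
    using that by (auto simp: c_def edge_at_eq)
  have x: "x p \<longleftrightarrow> \<delta> (side G (comm G p)) = (\<not> \<delta> p) \<and> \<delta> (side G p) = (\<not> \<delta> (comm G p))"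
    if "p \<in> flags G" for p
    using that by (auto simp: x_def edge_at_eq)
  have "A = c_edges G D \<longleftrightarrow> (\<forall>p\<in>flags G. edge_at G p \<in> A \<longleftrightarrow> c p)"
    using A by (auto simp: c_edges_def edges_def c_vertex_medial_vertex c_def \<delta>_def)
  moreover have "all_crossing_direction (medial_graph G) D \<longleftrightarrow>
      direction (medial_graph G) D \<and> (\<forall>p\<in>flags G. x p)"
    unfolding all_crossing_direction_def vertices_medial_graph edges_def x_def \<delta>_def
    by (simp add: crossing_medial_vertex)
  moreover have "(\<forall>p\<in>flags G. x p) \<and> (\<forall>p\<in>flags G. edge_at G p \<in> A \<longleftrightarrow> c p) \<longleftrightarrow>
      (\<forall>p\<in>flags G. r p)"
  proof -
    have "x p \<and> (edge_at G p \<in> A \<longleftrightarrow> c p)" if p: "p \<in> flags G" and r: "\<forall>p\<in>flags G. r p" for p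
    proof -
      \<comment> \<open>\<open>r p\<close> settles two neighbours of \<open>p\<close>; the fourth
        flag \<open>side G (comm G p)\<close> of the edge is reached from
        \<open>comm G p\<close>.\<close>
      have "r p" "r (comm G p)" using p r by auto
      then show ?thesis using p c[OF p] x[OF p] by (auto simp: r_def edge_at_comm)
    qed
    moreover have "r p" if "p \<in> flags G" "x p" "edge_at G p \<in> A \<longleftrightarrow> c p" for p
      using that c x unfolding r_def by auto
    ultimately show ?thesis by blast
  qed
  ultimately show ?thesis unfolding r_def \<delta>_def by blast
qed

lemma crossing_direction_iff_flag_colouring:
  assumes A: "A \<subseteq> edges G"
  shows "(\<exists>D. all_crossing_direction (medial_graph G) D \<and> A = c_edges G D) \<longleftrightarrow>
    (\<exists>\<delta>. \<forall>p\<in>flags G. \<delta> (arc G p) = (\<not> \<delta> p) \<and>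
      \<delta> (comm G p) = (\<delta> p = (edge_at G p \<in> A)) \<and>
      \<delta> (side G p) = (\<delta> p = (edge_at G p \<notin> A)))"
  (is "?L \<longleftrightarrow> (\<exists>\<delta>. ?P \<delta>)")
  unfolding c_edges_crossing_iff[OF A] direction_medial_graph
proof (intro iffI; elim exE)
  fix D :: "('f \<times> colour) set set"
  assume "(D \<subseteq> (\<lambda>p. {p} \<times> UNIV) ` flags G \<and>
      (\<forall>p\<in>flags G. ({arc G p} \<times> UNIV \<in> D) = ({p} \<times> UNIV \<notin> D))) \<and>
    (\<forall>p\<in>flags G.
      ({comm G p} \<times> UNIV \<in> D) = (({p} \<times> UNIV \<in> D) = (edge_at G p \<in> A)) \<and>
      ({side G p} \<times> UNIV \<in> D) = (({p} \<times> UNIV \<in> D) = (edge_at G p \<notin> A)))"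
  then have P: "?P (\<lambda>p. {p} \<times> UNIV \<in> D)" by simp
  show "\<exists>\<delta>. ?P \<delta>" by (rule exI[of ?P, OF P])
next
  fix \<delta> assume \<delta>: "?P \<delta>"
  \<comment> \<open>\<open>True\<close> stands for outgoing; restricting to flags makes
    \<open>D\<close> a set of genuine half-edges.\<close>
  define D where "D = (\<lambda>p. {p} \<times> (UNIV :: colour set)) ` {p \<in> flags G. \<delta> p}"
  have "{p} \<times> UNIV \<in> D \<longleftrightarrow> \<delta> p" if "p \<in> flags G" for p
    using that by (auto simp: D_def image_iff times_eq_iff)
  moreover have "D \<subseteq> (\<lambda>p. {p} \<times> UNIV) ` flags G" by (auto simp: D_def)
  ultimately show "\<exists>D. (D \<subseteq> (\<lambda>p. {p} \<times> (UNIV :: colour set)) ` flags G \<and>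
      (\<forall>p\<in>flags G. ({arc G p} \<times> UNIV \<in> D) = ({p} \<times> UNIV \<notin> D))) \<and>
    (\<forall>p\<in>flags G.
      ({comm G p} \<times> UNIV \<in> D) = (({p} \<times> UNIV \<in> D) = (edge_at G p \<in> A)) \<and>
      ({side G p} \<times> UNIV \<in> D) = (({p} \<times> UNIV \<in> D) = (edge_at G p \<notin> A)))"
    using \<delta> by (intro exI[of _ D]) simp
qed

section \<open>Partial duals and the comparison of the two kinds of colourings\<close>

lemma bipartite_partial_dual_iff_flag_colouring:
  "bipartite (underlying_graph (partial_dual G A)) \<longleftrightarrow>
    (\<exists>\<kappa>. \<forall>p\<in>flags G. \<kappa> (arc G p) = \<kappa> p \<and>
      \<kappa> (comm G p) = (\<kappa> p = (edge_at G p \<notin> A)) \<and>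
      \<kappa> (side G p) = (\<kappa> p = (edge_at G p \<in> A)))"
proof -
  interpret D: ribbon_graph "partial_dual G A" by (rule ribbon_graph_partial_dual)
  show ?thesis
    unfolding D.bipartite_iff_flag_colouring partial_dual_simps
    by (intro ex_cong1 ball_cong) (auto simp: partial_dual_simps)
qed

end

theorem theorem1p3:
  fixes G :: "('f, 'v) ribbon" and A :: "'f set set"
  assumes "ribbon_graph G" and "orientable G" and "A \<subseteq> edges G"
  shows "bipartite (underlying_graph (partial_dual G A)) \<longleftrightarrow>
    (\<exists>D. all_crossing_direction (medial_graph G) D \<and> A = c_edges G D)"
proof -
  interpret ribbon_graph G by fact
  obtain S T where "vertex_orientation G S" "edge_orientation G T"
      "\<forall>p\<in>flags G. p \<in> S \<longleftrightarrow> p \<notin> T"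
    using assms(2) unfolding orientable_def by blast
  \<comment> \<open>\<open>T\<close> changes along \<open>side\<close>, hence so does
    \<open>S\<close>, its complement on the flags.\<close>
  then have S: "\<forall>p\<in>flags G. (comm G p \<in> S) = (p \<notin> S) \<and> (arc G p \<in> S) = (p \<notin> S) \<and>
      (side G p \<in> S) = (p \<notin> S)"
    unfolding vertex_orientation_def edge_orientation_def by (metis flag_simps(4))
  show ?thesis
    unfolding bipartite_partial_dual_iff_flag_colouring
      crossing_direction_iff_flag_colouring[OF assms(3)]
  proof (intro iffI; elim exE)
    fix \<kappa> assume "\<forall>p\<in>flags G. \<kappa> (arc G p) = \<kappa> p \<and>
      \<kappa> (comm G p) = (\<kappa> p = (edge_at G p \<notin> A)) \<and> \<kappa> (side G p) = (\<kappa> p = (edge_at G p \<in> A))"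
    \<comment> \<open>The witness records agreement with the orientation \<open>S\<close>. As
      \<open>S\<close> changes along all three matchings, this turns constancy into change and
      change into constancy; the same operation leads back.\<close>
    with S show "\<exists>\<delta>. \<forall>p\<in>flags G. \<delta> (arc G p) = (\<not> \<delta> p) \<and>
      \<delta> (comm G p) = (\<delta> p = (edge_at G p \<in> A)) \<and> \<delta> (side G p) = (\<delta> p = (edge_at G p \<notin> A))"
      by (intro exI[of _ "\<lambda>p. \<kappa> p = (p \<in> S)"]) auto
  next
    fix \<delta> assume "\<forall>p\<in>flags G. \<delta> (arc G p) = (\<not> \<delta> p) \<and>
      \<delta> (comm G p) = (\<delta> p = (edge_at G p \<in> A)) \<and> \<delta> (side G p) = (\<delta> p = (edge_at G p \<notin> A))"
    with S show "\<exists>\<kappa>. \<forall>p\<in>flags G. \<kappa> (arc G p) = \<kappa> p \<and>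
      \<kappa> (comm G p) = (\<kappa> p = (edge_at G p \<notin> A)) \<and> \<kappa> (side G p) = (\<kappa> p = (edge_at G p \<in> A))"
      by (intro exI[of _ "\<lambda>p. \<delta> p = (p \<in> S)"]) auto
  qed
qed

end
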